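(* Let $d\ge1$ and $0<s<1$, and let $$p_s(t,x,y)=\frac1{(2\pi)^d}\int_{[-\pi,\pi]^d}e^{-t\Phi(\xi)^s}e^{i(x-y)\cdot\xi}\,d\xi,\qquad \Phi(\xi)=\sum_{j=1}^d(2-2\cos\xi_j),$$ be the fractional diffusion kernel on the standard lattice $\mathbb Z^d$. Then there is a constant $C>0$ (depending only on $s,d$) such that $$\sup_{x,y\in\mathbb Z^d}p_s(t,x,y)\le C\,t^{-d/(2s)}\qquad\text{for all }t>0,$$ and moreover, for all $x,y\in\mathbb Z^d$, $$\lim_{t\to\infty}t^{\frac d{2s}}\,p_s(t,x,y)=C_{s,d}:=\frac{\pi^{-d/2}}{s\,2^d\,\Gamma(\frac d2)}\,\Gamma\Bigl(\frac d{2s}\Bigr).$$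
   Context: The standard lattice $\mathbb Z^d$ carries unit vertex measure and unit edge weights between nearest neighbours, with Laplacian $\Delta u(x)=\sum_{y\sim x}(u(y)-u(x))$; $p_s(t,x,y)=(e^{-t(-\Delta)^s}\delta_y)(x)$ is the kernel of the semigroup generated by $-(-\Delta)^s$, given by the Fourier integral in the claim. *)

theory Defs
  imports "HOL-Analysis.Analysis"
begin

text \<open>
  The lattice \<open>\<int>\<^sup>d\<close> is the type \<open>int ^ 'd\<close>, with \<open>d = CARD('d)\<close>; an arbitrary finite (nonempty)
  index type stands for an arbitrary dimension \<open>d \<ge> 1\<close>.
\<close>

definition lattice_symbol :: "real ^ 'd \<Rightarrow> real" where
  "lattice_symbol \<xi> = (\<Sum>j\<in>UNIV. 2 - 2 * cos (\<xi> $ j))"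

definition torus_cube :: "(real ^ 'd) set" where
  "torus_cube = cbox (\<chi> j. - pi) (\<chi> j. pi)"

definition kernel_integrand ::
    "real \<Rightarrow> real \<Rightarrow> int ^ 'd \<Rightarrow> int ^ 'd \<Rightarrow> real ^ 'd \<Rightarrow> complex" where
  "kernel_integrand s t x y \<xi> =
     of_real (exp (- t * lattice_symbol \<xi> powr s)) *
     exp (\<i> * of_real ((\<chi> j. real_of_int (x $ j - y $ j)) \<bullet> \<xi>))"

text \<open>
  The Fourier integral is real because \<^term>\<open>lattice_symbol\<close> is even; the kernel is made real-valued
  by taking the real part. Lemma \<open>of_real_frac_kernel\<close> shows that nothing is lost.
\<close>

definition frac_kernel :: "real \<Rightarrow> real \<Rightarrow> int ^ 'd \<Rightarrow> int ^ 'd \<Rightarrow> real" where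
  "frac_kernel s t x y =
     Re (1 / (2 * of_real pi) ^ CARD('d) *
         (LINT \<xi>:torus_cube|lborel. kernel_integrand s t x y \<xi>))"

lemma lattice_symbol_nonneg: "0 \<le> lattice_symbol \<xi>"
  unfolding lattice_symbol_def by (rule sum_nonneg) simp

lemma set_integrable_kernel_integrand:
  assumes "0 < s"
  shows "set_integrable lborel torus_cube (kernel_integrand s t x y)"
proof -
  have "continuous_on torus_cube (lattice_symbol :: real ^ 'a \<Rightarrow> real)"
    unfolding lattice_symbol_def by (intro continuous_intros)
  then have "continuous_on torus_cube (\<lambda>\<xi> :: real ^ 'a. lattice_symbol \<xi> powr s)"
    using assms lattice_symbol_nonneg by (intro continuous_on_powr') auto
  moreover have "continuous_on torus_cube g \<Longrightarrow> continuous_on torus_cube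
      (\<lambda>\<xi>. complex_of_real (exp (- t * g \<xi>)) *
        exp (\<i> * of_real ((\<chi> j. real_of_int (x $ j - y $ j)) \<bullet> \<xi>)))" for g
    by (intro continuous_intros)
  ultimately have "continuous_on torus_cube (kernel_integrand s t x y)"
    unfolding kernel_integrand_def by blast
  then show ?thesis
    unfolding set_integrable_def
    by (intro borel_integrable_compact) (auto simp: torus_cube_def)
qed

lemma of_real_frac_kernel:
  fixes x y :: "int ^ 'd"
  assumes "0 < s"
  shows "complex_of_real (frac_kernel s t x y) =
    1 / (2 * of_real pi) ^ CARD('d) * (LINT \<xi>:torus_cube|lborel. kernel_integrand s t x y \<xi>)"
proof -
  let ?f = "kernel_integrand s t x y"
  let ?I = "integral torus_cube ?f"
  have int: "?f integrable_on torus_cube"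
    and eq: "(LINT \<xi>:torus_cube|lborel. ?f \<xi>) = ?I"
    using set_borel_integral_eq_integral[OF set_integrable_kernel_integrand[OF assms]] by auto
  have f: "(?f has_integral ?I) torus_cube"
    using int by (rule integrable_integral)
  have neg: "?f (- \<xi>) = cnj (?f \<xi>)" for \<xi>
    by (simp add: kernel_integrand_def lattice_symbol_def exp_cnj)
  have minus: "- (\<chi> j. pi) = ((\<chi> j. - pi) :: real ^ 'd)" "- (\<chi> j. - pi) = ((\<chi> j. pi) :: real ^ 'd)"
    by (simp_all add: vec_eq_iff)
  have cube: "torus_cube = cbox (- (\<chi> j. pi)) (- (\<chi> j. - pi) :: real ^ 'd)"
    unfolding torus_cube_def minus ..
  have "((\<lambda>\<xi>. ?f (- \<xi>)) has_integral ?I) torus_cube"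
    using f by (subst cube, subst has_integral_reflect) (simp flip: torus_cube_def)
  moreover have "((\<lambda>\<xi>. cnj (?f \<xi>)) has_integral cnj ?I) torus_cube"
    using has_integral_linear[OF f bounded_linear_cnj] by (simp add: o_def)
  ultimately have "cnj ?I = ?I"
    unfolding neg by (rule has_integral_unique[symmetric])
  then have "?I \<in> \<real>"
    by (simp add: Reals_cnj_iff)
  then obtain r where "?I = of_real r"
    by (auto elim: Reals_cases)
  then have "1 / (2 * of_real pi) ^ CARD('d) * ?I = of_real (1 / (2 * pi) ^ CARD('d) * r)"
    by simp
  then show ?thesis
    unfolding frac_kernel_def eq by (metis Re_complex_of_real)
qed

end

theory Submission
  imports Defs "HOL-Real_Asymp.Real_Asymp"
begin

text \<open>
  The large-time behaviour is governed by the frequencies near \<open>0\<close>, where the symbol \<open>\<Phi>\<close> of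
  \<open>-\<Delta>\<close> behaves like \<open>|\<xi>|\<^sup>2\<close>. Put \<open>\<tau> = t powr (-1/(2s))\<close> and substitute \<open>\<xi> = \<tau>\<eta>\<close> in the
  Fourier integral. The Jacobian \<open>\<tau> ^ d\<close> cancels the factor \<open>t powr (d/(2s))\<close>, and since
  \<open>t = 1 / (\<tau>\<^sup>2 powr s)\<close>, the exponent \<open>t * \<Phi>(\<xi>) powr s\<close> becomes \<open>(\<Phi>(\<tau>\<eta>) / \<tau>\<^sup>2) powr s\<close>
  (\<open>frac_kernel_rescaled\<close>). Both claims are then statements about
  one family of integrands on the whole space, indexed by \<open>\<tau>\<close>.

  Jordan's inequality \<open>sin u \<ge> 2u/\<pi>\<close> on \<open>[0, \<pi>/2]\<close> gives \<open>\<Phi>(\<xi>) \<ge> |2\<xi>/\<pi>|\<^sup>2\<close> on the torus cube, so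
  the family is dominated, uniformly in \<open>\<tau>\<close> and in the lattice points, by a stretched Gaussian
  (\<open>rescaled_integrand_bound\<close>). Its integral divided by \<open>(2\<pi>) ^ d\<close> is the constant in the uniform bound, and it allows
  dominated convergence as \<open>\<tau>\<close> tends to \<open>0\<close>: the cube exhausts the space, the oscillating factor
  tends to \<open>1\<close>, and \<open>\<Phi>(\<tau>\<eta>) / \<tau>\<^sup>2\<close> tends to \<open>|\<eta>|\<^sup>2\<close>. The limit is \<open>1 / (2\<pi>) ^ d\<close> times
  the integral of \<open>exp (-|\<eta>|\<^sup>p)\<close> with \<open>p = 2s\<close>, which \<open>nn_integral_exp_norm_powr\<close> evaluates by
  slicing into balls.
\<close>

section \<open>The stretched Gaussian integral\<close>

text \<open>
  Layer-cake argument: \<open>exp (-a)\<close> is the integral of \<open>exp (-u)\<close> over \<open>u \<ge> a\<close>. With \<open>a = |x|\<^sup>p\<close> and the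
  order of integration exchanged, the slice at height \<open>u\<close> is a ball of radius \<open>u powr (1/p)\<close>, and
  integrating its volume against \<open>exp (-u)\<close> produces a Gamma integral.
\<close>

lemma nn_integral_exp_norm_powr:
  fixes p :: real
  assumes p: "0 < p"
  shows "(\<integral>\<^sup>+ (x :: 'a :: euclidean_space). ennreal (exp (- (norm x powr p))) \<partial>lborel) =
    ennreal (unit_ball_vol (real DIM('a)) * Gamma (real DIM('a) / p + 1))"
proof -
  let ?d = "real DIM('a)"
  let ?h = "\<lambda>(x :: 'a) u :: real. ennreal (exp (- u)) * indicator {norm x powr p ..} u"
  have tail: "ennreal (exp (- a)) = (\<integral>\<^sup>+ u. ennreal (exp (- u)) * indicator {a ..} u \<partial>lborel)" for a :: real
  proof -
    have "(\<integral>\<^sup>+ u. ennreal (exp (- u)) * indicator {a ..} u \<partial>lborel) = ennreal (0 - (- exp (- a)))"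
    proof (rule nn_integral_FTC_atLeast)
      show "((\<lambda>u :: real. - exp (- u)) \<longlongrightarrow> 0) at_top"
        by real_asymp
    qed (auto intro!: derivative_eq_intros)
    then show ?thesis
      by simp
  qed
  have slice: "(\<integral>\<^sup>+ x. ?h x u \<partial>lborel) =
      ennreal (unit_ball_vol ?d) *
      ennreal (indicator {0..} u * u powr ((?d / p + 1) - 1) / exp u)" for u
  proof (cases "0 \<le> u")
    case True
    have "(norm x powr p \<le> u) = (norm x \<le> u powr (1 / p))" for x :: 'a
    proof
      assume "norm x powr p \<le> u"
      then have "(norm x powr p) powr (1 / p) \<le> u powr (1 / p)"
        using p by (intro powr_mono2) auto
      then show "norm x \<le> u powr (1 / p)"
        using p by (simp add: powr_powr)
    next
      assume "norm x \<le> u powr (1 / p)"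
      then have "norm x powr p \<le> (u powr (1 / p)) powr p"
        using p by (intro powr_mono2) auto
      then show "norm x powr p \<le> u"
        using p True by (simp add: powr_powr)
    qed
    then have "?h x u = ennreal (exp (- u)) * indicator (cball 0 (u powr (1 / p))) x" for x :: 'a
      by (simp add: indicator_def)
    then have "(\<integral>\<^sup>+ x. ?h x u \<partial>lborel) =
        ennreal (exp (- u)) * emeasure lborel (cball (0 :: 'a) (u powr (1 / p)))"
      by (simp add: nn_integral_cmult_indicator)
    also have "\<dots> = ennreal (exp (- u)) * ennreal (unit_ball_vol ?d * (u powr (1 / p)) ^ DIM('a))"
      by (subst emeasure_cball) auto
    also have "(u powr (1 / p)) ^ DIM('a) = u powr (?d / p)"
      by (cases "u = 0") (auto simp: powr_power)
    finally show ?thesis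
      using True by (simp add: ennreal_mult[symmetric] exp_minus field_simps)
  next
    case False
    then have "\<not> norm x powr p \<le> u" for x :: 'a
      using powr_ge_zero[of "norm x" p] by linarith
    then show ?thesis
      using False by simp
  qed
  have [measurable]: "(\<lambda>(x, u). ?h x u) \<in> borel_measurable (lborel \<Otimes>\<^sub>M lborel)"
  proof -
    have "(\<lambda>(x, u). ?h x u) =
        (\<lambda>z. ennreal (exp (- snd z)) * indicator {z. norm (fst z) powr p \<le> snd z} z)"
      by (auto simp: fun_eq_iff indicator_def)
    moreover have "(\<lambda>z :: 'a \<times> real. ennreal (exp (- snd z)) * indicator {z. norm (fst z) powr p \<le> snd z} z)
        \<in> borel_measurable (lborel \<Otimes>\<^sub>M lborel)"
      by measurable
    ultimately show ?thesis
      by simp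
  qed
  have "(\<integral>\<^sup>+ (x :: 'a). ennreal (exp (- (norm x powr p))) \<partial>lborel) =
      (\<integral>\<^sup>+ x. \<integral>\<^sup>+ u. ?h x u \<partial>lborel \<partial>lborel)"
    by (intro nn_integral_cong tail)
  also have "\<dots> = (\<integral>\<^sup>+ u. \<integral>\<^sup>+ x. ?h x u \<partial>lborel \<partial>lborel)"
    by (rule lborel_pair.Fubini'[symmetric]) measurable
  also have "\<dots> = ennreal (unit_ball_vol ?d) * ennreal (Gamma (?d / p + 1))"
    \<comment> \<open>The slice at height \<open>u\<close> is the integrand of \<open>\<Gamma>(d/p + 1)\<close> times the unit ball volume.\<close>
    using p
    by (simp only: slice)
      (subst nn_integral_cmult, auto simp: Gamma_conv_nn_integral_real add_nonneg_pos)
  finally show ?thesis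
    by (simp add: ennreal_mult')
qed

lemma has_bochner_integral_exp_norm_powr:
  fixes p :: real
  assumes p: "0 < p"
  shows "has_bochner_integral lborel (\<lambda>x :: 'a :: euclidean_space. exp (- (norm x powr p)))
    (unit_ball_vol (real DIM('a)) * Gamma (real DIM('a) / p + 1))"
proof (rule has_bochner_integral_nn_integral)
  have "0 < real DIM('a) / p + 1"
    using p by (simp add: add_nonneg_pos)
  then show "0 \<le> unit_ball_vol (real DIM('a)) * Gamma (real DIM('a) / p + 1)"
    by (intro mult_nonneg_nonneg unit_ball_vol_nonneg of_nat_0_le_iff less_imp_le[OF Gamma_real_pos])
  show "(\<integral>\<^sup>+ (x :: 'a). ennreal (exp (- (norm x powr p))) \<partial>lborel) =
      ennreal (unit_ball_vol (real DIM('a)) * Gamma (real DIM('a) / p + 1))"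
    using p by (rule nn_integral_exp_norm_powr)
qed simp_all

text \<open>
  The Jacobian of the dilation is placed on the side of the undilated integrand so that no division
  occurs; the equivalence transfers integrability together with the value.
\<close>

lemma lborel_has_bochner_integral_scaleR_iff:
  fixes f :: "'a :: euclidean_space \<Rightarrow> 'b :: {banach, second_countable_topology}"
  assumes c: "c \<noteq> 0" and [measurable]: "f \<in> borel_measurable borel"
  shows "has_bochner_integral lborel (\<lambda>x. f (c *\<^sub>R x)) i \<longleftrightarrow>
    has_bochner_integral lborel f (\<bar>c\<bar> ^ DIM('a) *\<^sub>R i)"
proof -
  define k where "k = \<bar>c\<bar> ^ DIM('a)"
  define D where "D = distr lborel borel (\<lambda>x :: 'a. c *\<^sub>R x)"
  have k: "0 < k"
    using c by (simp add: k_def)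
  have affine: "lborel = density D (\<lambda>_. ennreal k)"
    using lborel_affine[OF c, of "0 :: 'a"] by (simp only: k_def D_def add_0)
  have [measurable]: "f \<in> borel_measurable D"
    by (simp add: D_def)
  have distr: "has_bochner_integral D f i \<longleftrightarrow> has_bochner_integral lborel (\<lambda>x. f (c *\<^sub>R x)) i"
    by (simp add: D_def has_bochner_integral_iff integrable_distr_eq integral_distr)
  have dens: "has_bochner_integral D (\<lambda>x. k *\<^sub>R f x) j \<Longrightarrow>
      has_bochner_integral (density D (\<lambda>_. ennreal k)) f j" for j
    using k by (intro has_bochner_integral_density) auto
  show ?thesis
    unfolding k_def[symmetric]
  proof
    assume "has_bochner_integral lborel (\<lambda>x. f (c *\<^sub>R x)) i"
    then have "has_bochner_integral D (\<lambda>x. k *\<^sub>R f x) (k *\<^sub>R i)"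
      unfolding distr[symmetric] by (rule has_bochner_integral_scaleR_right)
    from dens[OF this] show "has_bochner_integral lborel f (k *\<^sub>R i)"
      unfolding affine[symmetric] .
  next
    assume "has_bochner_integral lborel f (k *\<^sub>R i)"
    then have "has_bochner_integral (density D (\<lambda>_. ennreal k)) f (k *\<^sub>R i)"
      unfolding affine[symmetric] .
    then have "integrable D (\<lambda>x. k *\<^sub>R f x)" "(LINT x|D. k *\<^sub>R f x) = k *\<^sub>R i"
      using k by (simp_all only: has_bochner_integral_iff integrable_density integral_density
          less_imp_le AE_I2 \<open>f \<in> borel_measurable D\<close> borel_measurable_const)
    then have "has_bochner_integral D (\<lambda>x. k *\<^sub>R f x) (k *\<^sub>R i)"
      unfolding has_bochner_integral_iff by (intro conjI)
    then have "has_bochner_integral D (\<lambda>x. inverse k *\<^sub>R k *\<^sub>R f x) (inverse k *\<^sub>R k *\<^sub>R i)"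
      by (rule has_bochner_integral_scaleR_right)
    then show "has_bochner_integral lborel (\<lambda>x. f (c *\<^sub>R x)) i"
      using k by (simp add: distr)
  qed
qed

section \<open>The lattice symbol\<close>

text \<open>Concavity: on \<open>[0, \<pi>/2]\<close> the sine lies above its chord.\<close>

lemma Jordan_sin_ge:
  assumes "0 \<le> x" "x \<le> pi / 2"
  shows "2 / pi * x \<le> sin x"
proof -
  have "concave_on {0..pi / 2} sin"
    by (rule f''_le0_imp_concave[where f' = cos and f'' = "\<lambda>x. - sin x"])
      (auto intro!: derivative_eq_intros sin_ge_zero)
  from concave_onD[OF this, of "2 * x / pi" 0 "pi / 2"] assms show ?thesis
    by (simp add: field_simps)
qed

text \<open>Jordan's inequality at \<open>|x|/2\<close>, since \<open>2 - 2 cos x = 4 sin\<^sup>2 (x/2)\<close>.\<close>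

lemma two_minus_two_cos_ge:
  assumes "\<bar>x\<bar> \<le> pi"
  shows "(2 / pi * x)\<^sup>2 \<le> 2 - 2 * cos x"
proof -
  have "2 / pi * \<bar>x / 2\<bar> \<le> sin \<bar>x / 2\<bar>"
    using assms by (intro Jordan_sin_ge) auto
  then have "(2 / pi * \<bar>x / 2\<bar>)\<^sup>2 \<le> (sin \<bar>x / 2\<bar>)\<^sup>2"
    by (intro power_mono) auto
  also have "(sin \<bar>x / 2\<bar>)\<^sup>2 = (1 - cos x) / 2"
    using cos_double_sin[of "x / 2"] by (simp add: abs_if)
  finally show ?thesis
    by (simp add: power_mult_distrib power_divide)
qed

text \<open>
  The lattice symbol vanishes on the cube only at the origin, and only to second order. This is the
  source of the decay rate: it bounds the heat factor by a stretched Gaussian.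
\<close>

lemma lattice_symbol_ge:
  fixes \<xi> :: "real ^ 'd"
  assumes "\<xi> \<in> torus_cube"
  shows "(norm ((2 / pi) *\<^sub>R \<xi>))\<^sup>2 \<le> lattice_symbol \<xi>"
proof -
  have "(norm ((2 / pi) *\<^sub>R \<xi>))\<^sup>2 = (\<Sum>j\<in>UNIV. (2 / pi * \<xi> $ j)\<^sup>2)"
    by (subst norm_vec_def, subst L2_set_def)
      (simp only: real_sqrt_pow2 sum_nonneg zero_le_power2 real_norm_def power2_abs
        vector_scaleR_component real_scaleR_def)
  also have "\<dots> \<le> lattice_symbol \<xi>"
    unfolding lattice_symbol_def using assms
    by (intro sum_mono two_minus_two_cos_ge) (auto simp: torus_cube_def mem_box_cart abs_le_iff minus_le_iff)
  finally show ?thesis .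
qed

text \<open>
  The second-order expansion of \<open>\<Phi>\<close> at the origin, in the form in which the dilation uses it: at low
  frequency the lattice Laplacian looks like the Euclidean one.
\<close>

lemma lattice_symbol_rescaled_tendsto:
  fixes \<eta> :: "real ^ 'd"
  shows "((\<lambda>\<tau>. lattice_symbol (\<tau> *\<^sub>R \<eta>) / \<tau>\<^sup>2) \<longlongrightarrow> (norm \<eta>)\<^sup>2) (at_right 0)"
proof -
  have "((\<lambda>\<tau>. (2 - 2 * cos (\<tau> * a)) / \<tau>\<^sup>2) \<longlongrightarrow> a\<^sup>2) (at_right 0)" for a :: real
  proof (cases "a = 0")
    case False
    then show ?thesis
      unfolding power2_eq_square by real_asymp
  qed simp
  then have "((\<lambda>\<tau>. \<Sum>j\<in>UNIV. (2 - 2 * cos (\<tau> * \<eta> $ j)) / \<tau>\<^sup>2) \<longlongrightarrow> (\<Sum>j\<in>UNIV. (\<eta> $ j)\<^sup>2)) (at_right 0)"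
    by (intro tendsto_sum)
  then show ?thesis
    by (simp add: lattice_symbol_def sum_divide_distrib norm_vec_def L2_set_def sum_nonneg)
qed

section \<open>The kernel in the diffusive scaling\<close>

text \<open>
  The Fourier integrand after \<open>\<xi> = \<tau>\<eta>\<close>, extended by \<open>0\<close> from the dilated cube to the whole space;
  \<open>v\<close> stands for \<open>x - y\<close>. Time enters only through \<open>\<tau>\<close>.
\<close>

definition rescaled_integrand :: "real \<Rightarrow> real ^ 'd \<Rightarrow> real \<Rightarrow> real ^ 'd \<Rightarrow> real" where
  "rescaled_integrand s v \<tau> \<eta> =
     indicator torus_cube (\<tau> *\<^sub>R \<eta>) *
     (exp (- ((lattice_symbol (\<tau> *\<^sub>R \<eta>) / \<tau>\<^sup>2) powr s)) * cos (v \<bullet> (\<tau> *\<^sub>R \<eta>)))"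

lemma borel_measurable_lattice_symbol [measurable]: "lattice_symbol \<in> borel_measurable borel"
  unfolding lattice_symbol_def by (intro borel_measurable_continuous_onI continuous_intros)

lemma torus_cube_in_borel [measurable]: "torus_cube \<in> sets borel"
  by (simp add: torus_cube_def)

lemma borel_measurable_rescaled_integrand [measurable]:
  "rescaled_integrand s v \<tau> \<in> borel_measurable borel"
  unfolding rescaled_integrand_def by measurable

text \<open>
  Taking the real part inside the integral turns the character into a cosine, so that the remaining
  analysis is about real integrands.
\<close>

lemma frac_kernel_eq_LINT_cos:
  fixes x y :: "int ^ 'd"
  assumes "0 < s"
  shows "frac_kernel s t x y =
    (LINT \<xi>|lborel. indicator torus_cube \<xi> *
      (exp (- t * lattice_symbol \<xi> powr s) * cos ((\<chi> j. real_of_int (x $ j - y $ j)) \<bullet> \<xi>)))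
      / (2 * pi) ^ CARD('d)"
proof -
  let ?f = "kernel_integrand s t x y"
  have "frac_kernel s t x y = Re (LINT \<xi>:torus_cube|lborel. ?f \<xi>) / (2 * pi) ^ CARD('d)"
  proof -
    have "1 / (2 * complex_of_real pi) ^ CARD('d) = of_real (1 / (2 * pi) ^ CARD('d))"
      by simp
    then show ?thesis
      unfolding frac_kernel_def by (simp only: Re_complex_of_real) (simp add: Re_complex_of_real)
  qed
  also have "Re (LINT \<xi>:torus_cube|lborel. ?f \<xi>) = (LINT \<xi>|lborel. Re (indicator torus_cube \<xi> *\<^sub>R ?f \<xi>))"
    using set_integrable_kernel_integrand[OF assms, of t x y]
    unfolding set_lebesgue_integral_def set_integrable_def by (rule integral_Re[symmetric])
  also have "\<dots> = (LINT \<xi>|lborel. indicator torus_cube \<xi> *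
      (exp (- t * lattice_symbol \<xi> powr s) * cos ((\<chi> j. real_of_int (x $ j - y $ j)) \<bullet> \<xi>)))"
    by (simp add: kernel_integrand_def Re_exp)
  finally show ?thesis .
qed

text \<open>
  The diffusive scaling: \<open>\<tau>\<close> is chosen so that \<open>t\<close> is absorbed by the homogeneity of the limiting
  symbol, and the Jacobian then accounts exactly for the factor \<open>t powr (d/(2s))\<close>.
\<close>

lemma frac_kernel_rescaled:
  fixes x y :: "int ^ 'd"
  assumes s: "0 < s" and t: "0 < t"
  shows "t powr (real CARD('d) / (2 * s)) * frac_kernel s t x y =
    (LINT \<eta>|lborel. rescaled_integrand s (\<chi> j. real_of_int (x $ j - y $ j))
      (t powr (- (1 / (2 * s)))) \<eta>) / (2 * pi) ^ CARD('d)"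
proof -
  define v :: "real ^ 'd" where "v = (\<chi> j. real_of_int (x $ j - y $ j))"
  define \<tau> where "\<tau> = t powr (- (1 / (2 * s)))"
  define f where "f = (\<lambda>\<xi>. indicator torus_cube \<xi> * (exp (- t * lattice_symbol \<xi> powr s) * cos (v \<bullet> \<xi>)))"
  have \<tau>: "0 < \<tau>"
    using t by (simp add: \<tau>_def)
  have pow: "(\<tau>\<^sup>2) powr s = 1 / t"
  proof -
    have "\<tau>\<^sup>2 = t powr (- (1 / s))"
      using t by (subst \<tau>_def, subst powr_power) (auto simp: field_simps)
    then show ?thesis
      using s t by (simp only: powr_powr) (simp add: powr_minus_divide)
  qed
  have "f (\<tau> *\<^sub>R \<eta>) = rescaled_integrand s v \<tau> \<eta>" for \<eta>
    by (simp add: f_def rescaled_integrand_def powr_divide lattice_symbol_nonneg pow mult.commute)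
  then have "(LINT \<eta>|lborel. rescaled_integrand s v \<tau> \<eta>) = (LINT \<eta>|lborel. f (\<tau> *\<^sub>R \<eta>))"
    by simp
  also have "\<dots> = (LINT \<xi>|lborel. f \<xi>) / \<tau> ^ CARD('d)"
  proof -
    have meas: "f \<in> borel_measurable borel"
      unfolding f_def by measurable
    have "integrable lborel f"
    proof -
      have "f = (\<lambda>\<xi>. Re (indicator torus_cube \<xi> *\<^sub>R kernel_integrand s t x y \<xi>))"
        by (simp add: fun_eq_iff f_def v_def kernel_integrand_def Re_exp)
      then show ?thesis
        using integrable_Re[OF set_integrable_kernel_integrand[OF s, of t x y, unfolded set_integrable_def]]
        by simp
    qed
    then have "has_bochner_integral lborel f (LINT \<xi>|lborel. f \<xi>)"
      by (rule has_bochner_integral_integrable)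
    moreover have "(LINT \<xi>|lborel. f \<xi>) = \<bar>\<tau>\<bar> ^ DIM(real ^ 'd) *\<^sub>R ((LINT \<xi>|lborel. f \<xi>) / \<tau> ^ CARD('d))"
      using \<tau> by simp
    ultimately have "has_bochner_integral lborel (\<lambda>\<eta>. f (\<tau> *\<^sub>R \<eta>)) ((LINT \<xi>|lborel. f \<xi>) / \<tau> ^ CARD('d))"
      using lborel_has_bochner_integral_scaleR_iff[of \<tau> f] meas \<tau> by simp
    then show ?thesis
      by (rule has_bochner_integral_integral_eq)
  qed
  also have "\<dots> = t powr (real CARD('d) / (2 * s)) * (LINT \<xi>|lborel. f \<xi>)"
    using t by (simp add: \<tau>_def powr_power powr_minus field_simps)
  finally show ?thesis
    unfolding frac_kernel_eq_LINT_cos[OF s] f_def v_def \<tau>_def by simp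
qed

text \<open>
  The quadratic lower bound for \<open>\<Phi>\<close> is invariant under the scaling, so the dominating function does
  not depend on \<open>\<tau>\<close>; the cosine is bounded by \<open>1\<close>, which makes it independent of \<open>v\<close> as well.
\<close>

lemma rescaled_integrand_bound:
  fixes \<eta> :: "real ^ 'd"
  assumes s: "0 < s" and \<tau>: "0 < \<tau>"
  shows "\<bar>rescaled_integrand s v \<tau> \<eta>\<bar> \<le> exp (- (norm ((2 / pi) *\<^sub>R \<eta>) powr (2 * s)))"
proof (cases "\<tau> *\<^sub>R \<eta> \<in> torus_cube")
  case True
  have "(norm ((2 / pi) *\<^sub>R \<eta>))\<^sup>2 * \<tau>\<^sup>2 \<le> lattice_symbol (\<tau> *\<^sub>R \<eta>)"
    using lattice_symbol_ge[OF True] \<tau> by (simp add: power_mult_distrib power_divide field_simps)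
  then have "(norm ((2 / pi) *\<^sub>R \<eta>))\<^sup>2 \<le> lattice_symbol (\<tau> *\<^sub>R \<eta>) / \<tau>\<^sup>2"
    using \<tau> by (simp only: pos_le_divide_eq zero_less_power)
  then have "((norm ((2 / pi) *\<^sub>R \<eta>))\<^sup>2) powr s \<le> (lattice_symbol (\<tau> *\<^sub>R \<eta>) / \<tau>\<^sup>2) powr s"
    using s by (intro powr_mono2) auto
  also have "((norm ((2 / pi) *\<^sub>R \<eta>))\<^sup>2) powr s = norm ((2 / pi) *\<^sub>R \<eta>) powr (2 * s)"
    by (simp only: powr_numeral[symmetric] norm_ge_zero powr_powr)
  finally have "exp (- ((lattice_symbol (\<tau> *\<^sub>R \<eta>) / \<tau>\<^sup>2) powr s)) * \<bar>cos (v \<bullet> (\<tau> *\<^sub>R \<eta>))\<bar> \<le>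
      exp (- (norm ((2 / pi) *\<^sub>R \<eta>) powr (2 * s))) * 1"
    by (intro mult_mono) auto
  then show ?thesis
    by (simp add: rescaled_integrand_def abs_mult True)
qed (simp add: rescaled_integrand_def)

text \<open>The cube is a neighbourhood of the origin, so its dilates exhaust the space.\<close>

lemma eventually_scaleR_in_torus_cube:
  fixes \<eta> :: "real ^ 'd"
  shows "eventually (\<lambda>\<tau>. \<tau> *\<^sub>R \<eta> \<in> torus_cube) (at_right 0)"
proof -
  have "((\<lambda>\<tau>. \<tau> *\<^sub>R \<eta>) \<longlongrightarrow> 0 *\<^sub>R \<eta>) (at_right 0)"
    by (intro tendsto_intros)
  moreover have "0 \<in> box (\<chi> j. - pi) ((\<chi> j. pi) :: real ^ 'd)"
    by (simp add: mem_box_cart)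
  ultimately have "eventually (\<lambda>\<tau>. \<tau> *\<^sub>R \<eta> \<in> box (\<chi> j. - pi) (\<chi> j. pi)) (at_right 0)"
    by (intro topological_tendstoD) (auto simp: open_box)
  then show ?thesis
    by (rule eventually_mono) (use box_subset_cbox in \<open>auto simp: torus_cube_def\<close>)
qed

lemma rescaled_integrand_tendsto:
  fixes \<eta> :: "real ^ 'd"
  assumes s: "0 < s"
  shows "((\<lambda>\<tau>. rescaled_integrand s v \<tau> \<eta>) \<longlongrightarrow> exp (- (norm \<eta> powr (2 * s)))) (at_right 0)"
proof -
  have "((\<lambda>\<tau>. exp (- ((lattice_symbol (\<tau> *\<^sub>R \<eta>) / \<tau>\<^sup>2) powr s)) * cos (v \<bullet> (\<tau> *\<^sub>R \<eta>)))
      \<longlongrightarrow> exp (- (((norm \<eta>)\<^sup>2) powr s)) * cos (v \<bullet> (0 *\<^sub>R \<eta>))) (at_right 0)"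
    using s by (intro tendsto_intros lattice_symbol_rescaled_tendsto)
      (auto simp: lattice_symbol_nonneg)
  moreover have "((norm \<eta>)\<^sup>2) powr s = norm \<eta> powr (2 * s)"
    by (simp only: powr_numeral[symmetric] norm_ge_zero powr_powr)
  ultimately have "((\<lambda>\<tau>. exp (- ((lattice_symbol (\<tau> *\<^sub>R \<eta>) / \<tau>\<^sup>2) powr s)) * cos (v \<bullet> (\<tau> *\<^sub>R \<eta>)))
      \<longlongrightarrow> exp (- (norm \<eta> powr (2 * s)))) (at_right 0)"
    by simp
  moreover have "eventually (\<lambda>\<tau>. exp (- ((lattice_symbol (\<tau> *\<^sub>R \<eta>) / \<tau>\<^sup>2) powr s)) *
      cos (v \<bullet> (\<tau> *\<^sub>R \<eta>)) = rescaled_integrand s v \<tau> \<eta>) (at_right 0)"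
    using eventually_scaleR_in_torus_cube[of \<eta>]
    by (rule eventually_mono) (simp add: rescaled_integrand_def)
  ultimately show ?thesis
    by (rule Lim_transform_eventually)
qed

section \<open>The uniform bound and the limit\<close>

definition diffusion_constant :: "real \<Rightarrow> nat \<Rightarrow> real" where
  "diffusion_constant s d =
     pi powr (- (real d / 2)) / (s * 2 ^ d * Gamma (real d / 2)) * Gamma (real d / (2 * s))"

lemma diffusion_constant_pos: "0 < s \<Longrightarrow> 0 < d \<Longrightarrow> 0 < diffusion_constant s d"
  unfolding diffusion_constant_def
  by (intro mult_pos_pos divide_pos_pos Gamma_real_pos) auto

text \<open>
  By \<open>\<Gamma>(z + 1) = z \<Gamma>(z)\<close>, applied both in the volume of the unit ball and in the stretched Gaussian
  integral, \<open>d/2\<close> in the denominator and \<open>d/(2s)\<close> in the numerator leave the factor \<open>1/s\<close>.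
\<close>

lemma diffusion_constant_eq:
  assumes "0 < s" "0 < d"
  shows "diffusion_constant s d =
    unit_ball_vol (real d) * Gamma (real d / (2 * s) + 1) / (2 * pi) ^ d"
proof -
  have "Gamma (real d / 2 + 1) = real d / 2 * Gamma (real d / 2)"
    using assms by (intro Gamma_plus1) (auto dest: nonpos_Ints_nonpos)
  moreover have "Gamma (real d / (2 * s) + 1) = real d / (2 * s) * Gamma (real d / (2 * s))"
  proof (rule Gamma_plus1)
    have "0 < real d / (2 * s)"
      using assms by simp
    then show "real d / (2 * s) \<notin> \<int>\<^sub>\<le>\<^sub>0"
      using nonpos_Ints_nonpos[of "real d / (2 * s)"] by linarith
  qed
  ultimately have "unit_ball_vol (real d) * Gamma (real d / (2 * s) + 1) / (2 * pi) ^ d =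
      pi powr (real d / 2) / (real d / 2 * Gamma (real d / 2)) *
      (real d / (2 * s) * Gamma (real d / (2 * s))) / (2 ^ d * pi ^ d)"
    unfolding unit_ball_vol_def by (simp only: power_mult_distrib)
  also have "\<dots> = (pi powr (real d / 2) / pi ^ d) / (s * 2 ^ d * Gamma (real d / 2)) *
      Gamma (real d / (2 * s))"
    using assms by simp
  also have "pi powr (real d / 2) / pi ^ d = pi powr (- (real d / 2))"
    by (simp add: powr_realpow[symmetric] powr_diff[symmetric])
  finally show ?thesis
    unfolding diffusion_constant_def ..
qed

lemma has_bochner_integral_exp_norm_powr_diffusion_constant:
  assumes "0 < s"
  shows "has_bochner_integral lborel (\<lambda>\<eta> :: real ^ 'd. exp (- (norm \<eta> powr (2 * s))))
    ((2 * pi) ^ CARD('d) * diffusion_constant s CARD('d))"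
proof -
  have "(2 * pi) ^ CARD('d) * diffusion_constant s CARD('d) =
      unit_ball_vol (real CARD('d)) * Gamma (real CARD('d) / (2 * s) + 1)"
    by (subst diffusion_constant_eq[OF assms]) (rule zero_less_card_finite, simp)
  moreover have "DIM(real ^ 'd) = CARD('d)"
    by simp
  ultimately show ?thesis
    using has_bochner_integral_exp_norm_powr[of "2 * s", where 'a = "real ^ 'd"] assms
    by (simp only: mult_pos_pos zero_less_numeral)
qed

text \<open>
  A dilate of the limiting integrand, so its integral is the limiting one times the Jacobian
  \<open>(\<pi>/2) ^ d\<close>. The constant in the uniform bound is therefore explicit.
\<close>

lemma has_bochner_integral_dominating:
  assumes s: "0 < s"
  shows "has_bochner_integral lborel (\<lambda>\<eta> :: real ^ 'd. exp (- (norm ((2 / pi) *\<^sub>R \<eta>) powr (2 * s))))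
    ((pi / 2) ^ CARD('d) * ((2 * pi) ^ CARD('d) * diffusion_constant s CARD('d)))"
proof -
  have "\<bar>2 / pi\<bar> ^ n *\<^sub>R ((pi / 2) ^ n * M) = M" for n and M :: real
  proof -
    have "\<bar>2 / pi\<bar> ^ n * (pi / 2) ^ n = (\<bar>2 / pi\<bar> * (pi / 2)) ^ n"
      by (rule power_mult_distrib[symmetric])
    also have "\<dots> = 1"
      by simp
    finally show ?thesis
      by (simp only: real_scaleR_def mult.assoc[symmetric] mult_1_left)
  qed
  from this[of "DIM(real ^ 'd)"]
  have "has_bochner_integral lborel (\<lambda>\<eta> :: real ^ 'd. exp (- (norm \<eta> powr (2 * s))))
      (\<bar>2 / pi\<bar> ^ DIM(real ^ 'd) *\<^sub>R
        ((pi / 2) ^ DIM(real ^ 'd) * ((2 * pi) ^ CARD('d) * diffusion_constant s CARD('d))))"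
    using has_bochner_integral_exp_norm_powr_diffusion_constant[OF s, where 'd = 'd]
    by (simp only:)
  then have "has_bochner_integral lborel (\<lambda>\<eta> :: real ^ 'd. exp (- (norm ((2 / pi) *\<^sub>R \<eta>) powr (2 * s))))
      ((pi / 2) ^ DIM(real ^ 'd) * ((2 * pi) ^ CARD('d) * diffusion_constant s CARD('d)))"
    by (rule lborel_has_bochner_integral_scaleR_iff[THEN iffD2, rotated 2]) auto
  moreover have "DIM(real ^ 'd) = CARD('d)"
    by simp
  ultimately show ?thesis
    by (simp only:)
qed

lemma frac_kernel_le:
  fixes x y :: "int ^ 'd"
  assumes s: "0 < s" and t: "0 < t"
  shows "frac_kernel s t x y \<le>
    (pi / 2) ^ CARD('d) * diffusion_constant s CARD('d) * t powr (- (real CARD('d) / (2 * s)))"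
proof -
  let ?F = "rescaled_integrand s (\<chi> j. real_of_int (x $ j - y $ j)) (t powr (- (1 / (2 * s))))"
  let ?M = "(pi / 2) ^ CARD('d) * diffusion_constant s CARD('d)"
  note dom = has_bochner_integral_dominating[OF s, where 'd = 'd]
  have bound: "\<bar>?F \<eta>\<bar> \<le> exp (- (norm ((2 / pi) *\<^sub>R \<eta>) powr (2 * s)))" for \<eta>
    using t by (intro rescaled_integrand_bound s) auto
  have "(LINT \<eta>|lborel. ?F \<eta>) \<le> (LINT \<eta>|lborel. exp (- (norm ((2 / pi) *\<^sub>R (\<eta> :: real ^ 'd)) powr (2 * s))))"
  proof (rule integral_mono)
    show "integrable lborel ?F"
      by (rule Bochner_Integration.integrable_bound[OF integrable.intros[OF dom]]) (use bound in auto)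
  qed (use bound abs_le_D1 integrable.intros[OF dom] in auto)
  also have "\<dots> = ?M * (2 * pi) ^ CARD('d)"
    using has_bochner_integral_integral_eq[OF dom] by (simp add: mult_ac)
  finally have "t powr (real CARD('d) / (2 * s)) * frac_kernel s t x y \<le> ?M"
    unfolding frac_kernel_rescaled[OF s t] by (simp add: pos_divide_le_eq)
  then show ?thesis
    using t by (simp add: powr_minus field_simps)
qed

lemma frac_kernel_tendsto:
  fixes x y :: "int ^ 'd"
  assumes s: "0 < s"
  shows "((\<lambda>t. t powr (real CARD('d) / (2 * s)) * frac_kernel s t x y)
    \<longlongrightarrow> diffusion_constant s CARD('d)) at_top"
proof -
  define F where "F = (\<lambda>t. rescaled_integrand s (\<chi> j. real_of_int (x $ j - y $ j)) (t powr (- (1 / (2 * s)))))"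
  have scale: "filterlim (\<lambda>t. t powr (- (1 / (2 * s)))) (at_right 0) at_top"
    using s by real_asymp
  have "((\<lambda>t. LINT \<eta>|lborel. F t \<eta>) \<longlongrightarrow>
      (LINT \<eta>|lborel. exp (- (norm (\<eta> :: real ^ 'd) powr (2 * s))))) at_top"
  proof (rule integral_dominated_convergence_at_top)
    show "integrable lborel (\<lambda>\<eta> :: real ^ 'd. exp (- (norm ((2 / pi) *\<^sub>R \<eta>) powr (2 * s))))"
      using has_bochner_integral_dominating[OF s] by (rule integrable.intros)
    show "AE \<eta> in lborel. ((\<lambda>t. F t \<eta>) \<longlongrightarrow> exp (- (norm \<eta> powr (2 * s)))) at_top"
      unfolding F_def by (intro AE_I2 filterlim_compose[OF rescaled_integrand_tendsto[OF s] scale])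
    show "\<forall>\<^sub>F t in at_top. AE \<eta> in lborel. norm (F t \<eta>) \<le> exp (- (norm ((2 / pi) *\<^sub>R \<eta>) powr (2 * s)))"
      using eventually_gt_at_top[of 0]
      by (rule eventually_mono) (auto simp: F_def intro!: rescaled_integrand_bound s simp del: norm_scaleR)
  qed (auto simp: F_def)
  then have "((\<lambda>t. (LINT \<eta>|lborel. F t \<eta>) / (2 * pi) ^ CARD('d)) \<longlongrightarrow>
      (2 * pi) ^ CARD('d) * diffusion_constant s CARD('d) / (2 * pi) ^ CARD('d)) at_top"
    unfolding has_bochner_integral_integral_eq[OF has_bochner_integral_exp_norm_powr_diffusion_constant[OF s]]
    by (intro tendsto_intros) auto
  then have "((\<lambda>t. (LINT \<eta>|lborel. F t \<eta>) / (2 * pi) ^ CARD('d)) \<longlongrightarrow> diffusion_constant s CARD('d)) at_top"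
    by simp
  moreover have "eventually (\<lambda>t. (LINT \<eta>|lborel. F t \<eta>) / (2 * pi) ^ CARD('d) =
      t powr (real CARD('d) / (2 * s)) * frac_kernel s t x y) at_top"
    using eventually_gt_at_top[of 0]
    by (rule eventually_mono) (simp add: F_def frac_kernel_rescaled[OF s])
  ultimately show ?thesis
    by (rule Lim_transform_eventually)
qed

theorem proposition1p9:
  fixes s :: real
  assumes "0 < s" and "s < 1"
  shows "(\<exists>C>0. \<forall>t>0.
            (SUP (x, y) \<in> (UNIV :: ((int ^ 'd) \<times> (int ^ 'd)) set). ereal (frac_kernel s t x y))
              \<le> ereal (C * t powr (- (real CARD('d) / (2 * s))))) \<and>
         (\<forall>x y :: int ^ 'd.
            ((\<lambda>t. t powr (real CARD('d) / (2 * s)) * frac_kernel s t x y) \<longlongrightarrow>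
               pi powr (- (real CARD('d) / 2))
                 / (s * 2 ^ CARD('d) * Gamma (real CARD('d) / 2))
                 * Gamma (real CARD('d) / (2 * s))) at_top)"
proof (intro conjI exI[of _ "(pi / 2) ^ CARD('d) * diffusion_constant s CARD('d)"] allI impI)
  show "0 < (pi / 2) ^ CARD('d) * diffusion_constant s CARD('d)"
    using assms by (intro mult_pos_pos diffusion_constant_pos) auto
next
  fix t :: real
  assume "0 < t"
  then show "(SUP (x, y) \<in> (UNIV :: ((int ^ 'd) \<times> (int ^ 'd)) set). ereal (frac_kernel s t x y))
      \<le> ereal ((pi / 2) ^ CARD('d) * diffusion_constant s CARD('d)
                * t powr (- (real CARD('d) / (2 * s))))"
    using frac_kernel_le[OF assms(1)] by (intro SUP_least) auto
next
  fix x y :: "int ^ 'd"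
  show "((\<lambda>t. t powr (real CARD('d) / (2 * s)) * frac_kernel s t x y) \<longlongrightarrow>
      pi powr (- (real CARD('d) / 2)) / (s * 2 ^ CARD('d) * Gamma (real CARD('d) / 2))
        * Gamma (real CARD('d) / (2 * s))) at_top"
    using frac_kernel_tendsto[OF assms(1), of x y] unfolding diffusion_constant_def .
qed

end
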